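(* Let $A$ be a multipartition matrix satisfying the generalized running intersection property (GRIP). Then the associated labeled tree $\mathcal{T}_A$ is a stratified and balanced staged tree.
   Context: Partition and multipartition matrices: write $[r]=\{1,\dots,r\}$. A partition matrix with $m$ columns is a $0/1$ matrix each of whose columns has exactly one entry equal to $1$; it is assumed to have no zero rows. A multipartition matrix $A=A^{1,\dots,k}$ is the stacking of partition matrices $A^1,\dots,A^k$ with $m$ columns (the ordered list is part of the data). $a^\ell_i$ is the $i$-th row of $A^\ell$ and $I^\ell_i\subset[m]$ its support. $A^{1,\dots,\ell}$ is the stacking of the first $\ell$ partitions, and $c^\ell_j$ the number of columns of $A^{1,\dots,\ell}$ equal to its $j$-th column (the $j$-th included). Well-connected: $A$ is well-connected if for every row $a^\ell_u$ with $\ell>1$ one has $c^\ell_j/c^{\ell-1}_j=c^\ell_{j'}/c^{\ell-1}_{j'}$ for all $j,j'\in I^\ell_u$. The matrix $\Cup_{n=1}^{\ell}A^n$: let $\beta$ be the number of distinct columns of $A^{1,\dots,\ell}$ and $\lambda:[m]\to[\beta]$ a surjective labeling with $\lambda(j)=\lambda(j')$ iff the $j$-th and $j'$-th columns of $A^{1,\dots,\ell}$ are equal. Then $\Cup_{n=1}^{\ell}A^n$ is the $\beta\times m$ partition matrix whose $j$-th column is the standard basis vector $e_{\lambda(j)}$. Matrix florets: let $B,C$ be partition matrices with $m$ columns; $BC$ denotes $B$ stacked above $C$ (a multipartition matrix with two partitions). A row of $B$ and a row of $C$ are connected if their supports intersect. $BC$ satisfies the floret condition if for any two rows of $B$, the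 sets of rows of $C$ connected to them are disjoint or equal. In that case the set of rows of $C$ connected to a given row of $B$ is a floret of $C$; let $\mathcal{F}^C_1,\dots,\mathcal{F}^C_f$ be the distinct florets of $C$. $B\Cap C$ is the $f\times m$ matrix whose $(t,j)$ entry is $1$ if the row of $C$ having $j$ in its support lies in $\mathcal{F}^C_t$, and $0$ otherwise. GRIP: with $B_\ell=\Cup_{n=1}^{\ell}A^n$, the matrix $A^{1,\dots,k}$ satisfies the GRIP if for each $\ell\in[k-1]$: (1) $B_\ell A^{\ell+1}$ is well-connected; (2) $B_\ell A^{\ell+1}$ satisfies the floret condition; (3) the rows of $B_\ell\Cap A^{\ell+1}$ lie in the rowspan of $A^{1,\dots,\ell}$. The tree $\mathcal{T}_A$: a directed rooted tree with edge labels $s^\ell_i$, one label for each row $a^\ell_i$ of $A$. Its vertices at level $\ell$ (distance $\ell$ from the root), $1\le\ell\le k$, are the distinct columns of $A^{1,\dots,\ell}$; level $0$ is the root. A level-$\ell$ vertex is the child of the level-$(\ell-1)$ vertex obtained by restricting the column to $A^{1,\dots,\ell-1}$ (of the root if $\ell=1$), and the edge is labeled $s^\ell_i$, where $a^\ell_i$ is the row of $A^\ell$ in which the column has entry $1$. Thus root-to-leaf paths correspond to the distinct columns of $A$. Staged trees: let $\mathcal{T}=(V,E)$ be a directed rooted tree with edge labeling $\theta$. For $v\in V$, $\mathrm{ch}(v)$ is the set of children of $v$, $E(v)$ the set of outgoing edges, and $\mathcal{F}_v=\{\theta(e):e\in E(v)\}$ the floret of $v$. $(\mathcal{T},\theta)$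 is a staged tree if for each $v$ no two edges in $E(v)$ have the same label, and for all $v,w\in V$ the sets $\mathcal{F}_v,\mathcal{F}_w$ are equal or disjoint. It is stratified if all leaves have the same level and $\mathcal{F}_v=\mathcal{F}_w$ implies that $v$ and $w$ have the same level. For $v\in V$ let $\Lambda_v$ be the set of $v$-to-leaf paths and $t(v)=\sum_{\lambda\in\Lambda_v}\prod_{e\in\lambda}\theta(e)$, a polynomial in the labels (so $t(v)=1$ for a leaf). A staged tree is balanced if for any $v,w\in V$ with $\mathcal{F}_v=\mathcal{F}_w$, $t(v')t(w'')=t(w')t(v'')$ for all distinct $v',v''\in\mathrm{ch}(v)$ and distinct $w',w''\in\mathrm{ch}(w)$ with $\theta(v,v')=\theta(w,w')$ and $\theta(v,v'')=\theta(w,w'')$. *)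

theory Defs
  imports
    "Jordan_Normal_Form.VS_Connect"
    "Graph_Theory.Pair_Digraph"
    "HOL-Library.Poly_Mapping"
begin

section \<open>Partition and multipartition matrices\<close>

text \<open>
  Matrices are those of \<open>Jordan_Normal_Form.Matrix\<close>; rows and columns are numbered from 0.
  A multipartition matrix is given by its ordered list of partition matrices, so \<open>A ! l\<close> is
  the partition usually written \<open>A^(l+1)\<close>. The number \<open>m\<close> of columns is an explicit parameter,
  because it is not determined by an empty list.
\<close>

definition partition_matrix :: "nat \<Rightarrow> real mat \<Rightarrow> bool" where
  "partition_matrix m B \<longleftrightarrow>
     dim_col B = m \<and>
     (\<forall>i<dim_row B. \<forall>j<m. B $$ (i, j) \<in> {0, 1}) \<and>
     (\<forall>j<m. \<exists>!i. i < dim_row B \<and> B $$ (i, j) = 1) \<and>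
     (\<forall>i<dim_row B. row B i \<noteq> 0\<^sub>v m)"

definition multipartition_matrix :: "nat \<Rightarrow> real mat list \<Rightarrow> bool" where
  "multipartition_matrix m A \<longleftrightarrow> (\<forall>B\<in>set A. partition_matrix m B)"

definition row_supp :: "real mat \<Rightarrow> nat \<Rightarrow> nat set" where
  "row_supp B i = {j. j < dim_col B \<and> B $$ (i, j) \<noteq> 0}"

text \<open>\<open>stack m A l\<close> is the matrix \<open>A^(1,...,l)\<close>; in particular \<open>stack m A 0\<close> has no rows.\<close>

definition stack :: "nat \<Rightarrow> real mat list \<Rightarrow> nat \<Rightarrow> real mat" where
  "stack m A l = foldr (@\<^sub>r) (take l A) (0\<^sub>m 0 m)"

definition col_count :: "nat \<Rightarrow> real mat list \<Rightarrow> nat \<Rightarrow> nat \<Rightarrow> nat" where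
  "col_count m A l j = card {j'. j' < m \<and> col (stack m A l) j' = col (stack m A l) j}"

definition well_connected :: "nat \<Rightarrow> real mat list \<Rightarrow> bool" where
  "well_connected m A \<longleftrightarrow>
     (\<forall>l. 1 < l \<and> l \<le> length A \<longrightarrow>
       (\<forall>u<dim_row (A ! (l - 1)).
         \<forall>j\<in>row_supp (A ! (l - 1)) u. \<forall>j'\<in>row_supp (A ! (l - 1)) u.
           real (col_count m A l j) / real (col_count m A (l - 1) j) =
           real (col_count m A l j') / real (col_count m A (l - 1) j')))"


section \<open>The matrices \<open>\<Cup>\<close> and \<open>\<Cap>\<close>, florets and the GRIP\<close>

text \<open>
  Both matrices below are only determined up to the order of their rows, that is, up to the
  choice of a labeling of the distinct columns, respectively of an enumeration of the florets.
  One such choice is fixed with \<open>SOME\<close>; the two lemmas show that a choice exists.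
\<close>

definition column_labeling :: "nat \<Rightarrow> real mat \<Rightarrow> (nat \<Rightarrow> nat) \<Rightarrow> bool" where
  "column_labeling m M lab \<longleftrightarrow>
     lab ` {..<m} = {..<card (col M ` {..<m})} \<and>
     (\<forall>j<m. \<forall>j'<m. lab j = lab j' \<longleftrightarrow> col M j = col M j')"

lemma column_labeling_exists: "\<exists>lab. column_labeling m M lab"
proof -
  let ?C = "col M ` {..<m}"
  obtain h where h: "bij_betw h ?C {0..<card ?C}"
    using ex_bij_betw_finite_nat[of ?C] by auto
  have "column_labeling m M (\<lambda>j. h (col M j))"
    unfolding column_labeling_def
  proof (intro conjI allI impI)
    have "(\<lambda>j. h (col M j)) ` {..<m} = h ` ?C" by auto
    also have "\<dots> = {..<card ?C}" using h by (simp add: bij_betw_def atLeast0LessThan)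
    finally show "(\<lambda>j. h (col M j)) ` {..<m} = {..<card ?C}" .
    fix j j' assume "j < m" "j' < m"
    then show "(h (col M j) = h (col M j')) = (col M j = col M j')"
      using h by (auto simp: bij_betw_def inj_on_def)
  qed
  then show ?thesis by blast
qed

definition cup_matrix :: "nat \<Rightarrow> real mat list \<Rightarrow> nat \<Rightarrow> real mat" where
  "cup_matrix m A l =
     (let M = stack m A l; lab = (SOME lab. column_labeling m M lab) in
      mat (card (col M ` {..<m})) m (\<lambda>(i, j). if i = lab j then 1 else 0))"

definition rows_connected :: "real mat \<Rightarrow> real mat \<Rightarrow> nat \<Rightarrow> nat \<Rightarrow> bool" where
  "rows_connected B C i i' \<longleftrightarrow> row_supp B i \<inter> row_supp C i' \<noteq> {}"

text \<open>The rows of \<open>C\<close> in a floret are represented by their indices.\<close>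

definition connected_rows :: "real mat \<Rightarrow> real mat \<Rightarrow> nat \<Rightarrow> nat set" where
  "connected_rows B C i = {i'. i' < dim_row C \<and> rows_connected B C i i'}"

definition floret_condition :: "real mat \<Rightarrow> real mat \<Rightarrow> bool" where
  "floret_condition B C \<longleftrightarrow>
     (\<forall>i1<dim_row B. \<forall>i2<dim_row B.
        connected_rows B C i1 \<inter> connected_rows B C i2 = {} \<or>
        connected_rows B C i1 = connected_rows B C i2)"

definition matrix_florets :: "real mat \<Rightarrow> real mat \<Rightarrow> nat set set" where
  "matrix_florets B C = connected_rows B C ` {..<dim_row B}"

lemma matrix_florets_enum: "\<exists>Fs. distinct Fs \<and> set Fs = matrix_florets B C"
  using finite_distinct_list[of "matrix_florets B C"] by (auto simp: matrix_florets_def)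

definition cap_matrix :: "real mat \<Rightarrow> real mat \<Rightarrow> real mat" where
  "cap_matrix B C =
     (let Fs = (SOME Fs. distinct Fs \<and> set Fs = matrix_florets B C) in
      mat (length Fs) (dim_col C)
        (\<lambda>(t, j). if (THE i. i < dim_row C \<and> j \<in> row_supp C i) \<in> Fs ! t then 1 else 0))"

definition GRIP :: "nat \<Rightarrow> real mat list \<Rightarrow> bool" where
  "GRIP m A \<longleftrightarrow>
     (\<forall>l. 1 \<le> l \<and> l < length A \<longrightarrow>
       (let B = cup_matrix m A l in
        well_connected m [B, A ! l] \<and>
        floret_condition B (A ! l) \<and>
        set (rows (cap_matrix B (A ! l))) \<subseteq> vec_space.row_space m (stack m A l)))"


section \<open>Staged trees\<close>

text \<open>
  A directed rooted tree is a finite digraph in which every vertex is reached from the root by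
  exactly one walk. Uniqueness is required of walks, not only of paths, in order to exclude arcs
  that lead back to an ancestor.
\<close>

definition rooted_tree :: "'v pair_pre_digraph \<Rightarrow> 'v \<Rightarrow> bool" where
  "rooted_tree T r \<longleftrightarrow>
     fin_digraph (with_proj T) \<and> r \<in> pverts T \<and>
     (\<forall>v\<in>pverts T. \<exists>!p. pre_digraph.awalk (with_proj T) r p v)"

definition level :: "'v pair_pre_digraph \<Rightarrow> 'v \<Rightarrow> 'v \<Rightarrow> nat" where
  "level T r v = (LEAST n. \<exists>p. pre_digraph.awalk (with_proj T) r p v \<and> length p = n)"

definition children :: "'v pair_pre_digraph \<Rightarrow> 'v \<Rightarrow> 'v set" where
  "children T v = {w. (v, w) \<in> parcs T}"

definition leaves :: "'v pair_pre_digraph \<Rightarrow> 'v set" where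
  "leaves T = {v\<in>pverts T. children T v = {}}"

definition floret :: "'v pair_pre_digraph \<Rightarrow> ('v \<times> 'v \<Rightarrow> 'l) \<Rightarrow> 'v \<Rightarrow> 'l set" where
  "floret T \<theta> v = \<theta> ` out_arcs (with_proj T) v"

definition staged_tree :: "'v pair_pre_digraph \<Rightarrow> 'v \<Rightarrow> ('v \<times> 'v \<Rightarrow> 'l) \<Rightarrow> bool" where
  "staged_tree T r \<theta> \<longleftrightarrow>
     rooted_tree T r \<and>
     (\<forall>v\<in>pverts T. inj_on \<theta> (out_arcs (with_proj T) v)) \<and>
     (\<forall>v\<in>pverts T. \<forall>w\<in>pverts T.
        floret T \<theta> v = floret T \<theta> w \<or> floret T \<theta> v \<inter> floret T \<theta> w = {})"

definition stratified :: "'v pair_pre_digraph \<Rightarrow> 'v \<Rightarrow> ('v \<times> 'v \<Rightarrow> 'l) \<Rightarrow> bool" where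
  "stratified T r \<theta> \<longleftrightarrow>
     (\<forall>v\<in>leaves T. \<forall>w\<in>leaves T. level T r v = level T r w) \<and>
     (\<forall>v\<in>pverts T. \<forall>w\<in>pverts T.
        floret T \<theta> v = floret T \<theta> w \<longrightarrow> level T r v = level T r w)"

text \<open>
  Polynomials over \<open>real\<close> with the labels as indeterminates: finitely supported functions from
  monomials (finitely supported exponent functions) to coefficients, with convolution product.
\<close>

type_synonym 'l label_poly = "('l \<Rightarrow>\<^sub>0 nat) \<Rightarrow>\<^sub>0 real"

definition label_var :: "'l \<Rightarrow> 'l label_poly" where
  "label_var s = Poly_Mapping.single (Poly_Mapping.single s 1) 1"

definition paths_to_leaves :: "'v pair_pre_digraph \<Rightarrow> 'v \<Rightarrow> ('v \<times> 'v) list set" where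
  "paths_to_leaves T v = {p. \<exists>u\<in>leaves T. pre_digraph.apath (with_proj T) v p u}"

definition path_poly ::
  "'v pair_pre_digraph \<Rightarrow> ('v \<times> 'v \<Rightarrow> 'l) \<Rightarrow> 'v \<Rightarrow> 'l label_poly" where
  "path_poly T \<theta> v = (\<Sum>p\<in>paths_to_leaves T v. \<Prod>e\<leftarrow>p. label_var (\<theta> e))"

definition balanced :: "'v pair_pre_digraph \<Rightarrow> ('v \<times> 'v \<Rightarrow> 'l) \<Rightarrow> bool" where
  "balanced T \<theta> \<longleftrightarrow>
     (\<forall>v\<in>pverts T. \<forall>w\<in>pverts T. floret T \<theta> v = floret T \<theta> w \<longrightarrow>
       (\<forall>v'\<in>children T v. \<forall>v''\<in>children T v. \<forall>w'\<in>children T w. \<forall>w''\<in>children T w.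
          v' \<noteq> v'' \<and> w' \<noteq> w'' \<and> \<theta> (v, v') = \<theta> (w, w') \<and> \<theta> (v, v'') = \<theta> (w, w'') \<longrightarrow>
          path_poly T \<theta> v' * path_poly T \<theta> w'' = path_poly T \<theta> w' * path_poly T \<theta> v''))"


section \<open>The labeled tree of a multipartition matrix\<close>

text \<open>
  A vertex is a pair of a level \<open>l\<close> and a column of \<open>A^(1,...,l)\<close>. The root is the unique vertex
  of level 0, carrying the empty column. The label \<open>s^l_i\<close> is the pair \<open>(l, i)\<close>, with \<open>l\<close> counted
  from 1 and \<open>i\<close> from 0.
\<close>

type_synonym column_vertex = "nat \<times> real vec"

definition tree_root :: column_vertex where
  "tree_root = (0, vNil)"

definition partition_tree :: "nat \<Rightarrow> real mat list \<Rightarrow> column_vertex pair_pre_digraph" where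
  "partition_tree m A =
     \<lparr> pverts = insert tree_root
         {(l, c) | l c. 1 \<le> l \<and> l \<le> length A \<and> c \<in> set (cols (stack m A l))},
       parcs = {((l - 1, vec_first c (dim_row (stack m A (l - 1)))), (l, c)) | l c.
         1 \<le> l \<and> l \<le> length A \<and> c \<in> set (cols (stack m A l))} \<rparr>"

text \<open>
  In a column of \<open>A^(1,...,l)\<close> the entries belonging to \<open>A^l\<close> come after those of
  \<open>A^(1,...,l-1)\<close>, whence the offset.
\<close>

definition tree_label ::
  "nat \<Rightarrow> real mat list \<Rightarrow> column_vertex \<times> column_vertex \<Rightarrow> nat \<times> nat" where
  "tree_label m A = (\<lambda>(u, (l, c)).
     (l, THE i. i < dim_row (A ! (l - 1)) \<and> c $ (dim_row (stack m A (l - 1)) + i) = 1))"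

end

theory Submission
  imports Defs
begin

text \<open>
  The vertex of level \<open>l\<close> given by column \<open>j\<close> has as floret the rows of the next partition that meet
  the columns agreeing with \<open>j\<close> up to level \<open>l\<close>, so the floret condition is exactly the staged tree
  condition within a level; labels record their level, which gives the rest of stagedness and
  stratification.

  For balancedness, let \<open>a, b, c, d\<close> be columns of the same matrix \<open>A^(1,...,l)\<close> with
  \<open>a + b = c + d\<close> as vectors. Then \<open>t(a) t(b) = t(c) t(d)\<close>, by induction from the leaves: the
  indicator function of a floret is in the row span, hence additive on columns, so \<open>a + b = c + d\<close>
  forces the unordered pairs of florets at \<open>a, b\<close> and at \<open>c, d\<close> to coincide. Expanding both products
  over these florets and extending matching vertices by the same labels preserves the relation.
  In the definition of balancedness the children satisfy \<open>v' + w'' = w' + v''\<close>.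
\<close>

subsection \<open>Graded rooted trees\<close>

text \<open>Conditions on single arcs that replace the uniqueness of walks in
  \<open>rooted_tree\<close>; it follows from them by induction on \<open>rank\<close>.\<close>

locale graded_tree = pair_fin_digraph G for G :: "'v pair_pre_digraph" +
  fixes r :: 'v and rank :: "'v \<Rightarrow> nat"
  assumes root_in_verts: "r \<in> pverts G"
    and rank_arc: "(u, v) \<in> parcs G \<Longrightarrow> rank v = Suc (rank u)"
    and rank_zero: "v \<in> pverts G \<Longrightarrow> rank v = 0 \<longleftrightarrow> v = r"
    and unique_parent: "v \<in> pverts G \<Longrightarrow> v \<noteq> r \<Longrightarrow> \<exists>!u. (u, v) \<in> parcs G"
begin

lemma rank_awalk: "awalk u p v \<Longrightarrow> rank v = rank u + length p"
  by (induction p arbitrary: u) (auto simp: awalk_simps dest: rank_arc)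

lemma rank_awalk_verts_ge: "awalk u p v \<Longrightarrow> x \<in> set (pawalk_verts u p) \<Longrightarrow> rank u \<le> rank x"
proof (induction p arbitrary: u)
  case (Cons e p)
  then obtain a b where e: "e = (a, b)" by (cases e)
  with Cons have "awalk b p v" "u = a" "rank b = Suc (rank a)"
    by (auto simp: awalk_simps dest: rank_arc)
  with Cons.IH[of b] Cons.prems(2) e show ?case by auto
qed auto

text \<open>\<open>rank\<close> grows on every arc, so the tail of the first arc cannot recur later.
  Leaf paths can thus be built arc by arc without checking for repeated vertices.\<close>

lemma apath_iff_awalk: "apath u p v \<longleftrightarrow> awalk u p v"
proof (induction p arbitrary: u)
  case (Cons e p)
  obtain a b where e: "e = (a, b)" by (cases e)
  have "a \<notin> set (pawalk_verts b p)" if "(a, b) \<in> parcs G" "awalk b p v"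
    using rank_awalk_verts_ge[OF that(2), of a] rank_arc[OF that(1)] by auto
  with Cons e show ?case by (auto simp: apath_simps awalk_simps)
qed (simp add: apath_Nil_iff awalk_Nil_iff)

text \<open>Induction on \<open>rank\<close>: a walk to a vertex other than the root ends with the
  arc from the unique parent, and the walk to the parent is unique.\<close>

lemma ex1_awalk_from_root: "v \<in> pverts G \<Longrightarrow> \<exists>!p. awalk r p v"
proof (induction "rank v" arbitrary: v)
  case 0
  then have v: "v = r" using rank_zero by simp
  show ?case
  proof (rule ex1I[of _ "[]"])
    show "awalk r [] v" using v root_in_verts by (simp add: awalk_Nil_iff)
    show "p = []" if "awalk r p v" for p using rank_awalk[OF that] v by simp
  qed
next
  case (Suc n)
  then have "v \<noteq> r" using rank_zero by fastforce
  then obtain u where u: "(u, v) \<in> parcs G" and uu: "\<And>u'. (u', v) \<in> parcs G \<Longrightarrow> u' = u"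
    using unique_parent Suc.prems by blast
  have "rank u = n" "u \<in> pverts G" using rank_arc[OF u] Suc.hyps(2) in_arcsD1[OF u] by auto
  then obtain p where p: "awalk r p u" and pu: "\<And>q. awalk r q u \<Longrightarrow> q = p"
    using Suc.hyps(1) by metis
  show ?case
  proof (rule ex1I[of _ "p @ [(u, v)]"])
    have "awalk u [(u, v)] v" using u in_arcsD2 by (auto simp: awalk_simps)
    then show "awalk r (p @ [(u, v)]) v" using p by (rule awalk_appendI[rotated])
    fix q assume q: "awalk r q v"
    with \<open>v \<noteq> r\<close> have "q \<noteq> []" by (auto simp: awalk_simps)
    then obtain q' x y where q': "q = q' @ [(x, y)]"
      by (metis append_butlast_last_id surj_pair)
    with q obtain w where w: "awalk r q' w" "awalk w [(x, y)] v"
      by (metis awalk_append_iff)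
    then have "y = v" "w = x" "(x, v) \<in> parcs G" by (auto simp: awalk_simps)
    with uu pu w q' show "q = p @ [(u, v)]" by auto
  qed
qed

lemma rooted_tree: "rooted_tree G r"
  unfolding rooted_tree_def using root_in_verts ex1_awalk_from_root fin_digraph_axioms by blast

text \<open>All walks from the root to \<open>v\<close> have length \<open>rank v\<close>, so the
  minimum in \<open>level\<close> ranges over one value.\<close>

lemma level_eq_rank:
  assumes "v \<in> pverts G"
  shows "level G r v = rank v"
proof -
  obtain p where p: "awalk r p v" using ex1_awalk_from_root assms by blast
  have "rank r = 0" using rank_zero root_in_verts by simp
  then have "(\<exists>p. awalk r p v \<and> length p = n) \<longleftrightarrow> n = rank v" for n
    using p rank_awalk by (metis add_0)
  then show ?thesis unfolding level_def by (auto intro: Least_equality)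
qed

section \<open>Leaf paths and the recursion for the path polynomial\<close>

lemma paths_to_leaves_leaf: "v \<in> leaves G \<Longrightarrow> paths_to_leaves G v = {[]}"
proof -
  assume v: "v \<in> leaves G"
  have "p = []" if "awalk v p u" for p u
    using v that by (cases p) (auto simp: awalk_simps leaves_def children_def)
  moreover have "awalk v [] v" using v by (simp add: awalk_simps leaves_def)
  ultimately show ?thesis
    using v unfolding paths_to_leaves_def apath_iff_awalk by fast
qed

lemma paths_to_leaves_inner:
  assumes "v \<notin> leaves G"
  shows "paths_to_leaves G v = (\<Union>w\<in>children G v. (#) (v, w) ` paths_to_leaves G w)"
proof (intro subset_antisym subsetI)
  fix p assume "p \<in> paths_to_leaves G v"
  then obtain u where u: "u \<in> leaves G" "awalk v p u"
    unfolding paths_to_leaves_def apath_iff_awalk by blast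
  with assms have "p \<noteq> []" by (auto simp: awalk_simps)
  then obtain w q where "p = (v, w) # q" "(v, w) \<in> parcs G" "awalk w q u"
    using u by (cases p) (auto simp: awalk_simps)
  with u show "p \<in> (\<Union>w\<in>children G v. (#) (v, w) ` paths_to_leaves G w)"
    unfolding paths_to_leaves_def apath_iff_awalk children_def by blast
next
  fix p assume "p \<in> (\<Union>w\<in>children G v. (#) (v, w) ` paths_to_leaves G w)"
  then show "p \<in> paths_to_leaves G v"
    unfolding paths_to_leaves_def apath_iff_awalk children_def
    by (auto simp: awalk_simps)
qed

lemma finite_leaves: "finite (leaves G)"
  unfolding leaves_def using pair_finite_verts by simp

lemma finite_paths_to_leaves: "finite (paths_to_leaves G v)"
proof -
  have "paths_to_leaves G v = (\<Union>u\<in>leaves G. {p. apath v p u})"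
    unfolding paths_to_leaves_def by blast
  then show ?thesis using finite_leaves apaths_finite by simp
qed

lemma finite_children: "finite (children G v)"
  by (rule finite_subset[OF _ pair_finite_verts]) (auto simp: children_def in_arcsD2)

lemma path_poly_leaf: "v \<in> leaves G \<Longrightarrow> path_poly G \<theta> v = 1"
  by (simp add: path_poly_def paths_to_leaves_leaf)

text \<open>Splits each leaf path after its first arc. Paths through distinct children differ in
  that arc, so the union is disjoint; finiteness keeps the sums from being the default value
  0.\<close>

lemma path_poly_inner:
  assumes "v \<notin> leaves G"
  shows "path_poly G \<theta> v = (\<Sum>w\<in>children G v. label_var (\<theta> (v, w)) * path_poly G \<theta> w)"
proof -
  have "path_poly G \<theta> v =
      (\<Sum>w\<in>children G v. \<Sum>p\<in>(#) (v, w) ` paths_to_leaves G w. \<Prod>e\<leftarrow>p. label_var (\<theta> e))"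
    unfolding path_poly_def paths_to_leaves_inner[OF assms]
    by (rule sum.UNION_disjoint) (auto simp: finite_children finite_paths_to_leaves)
  also have "\<dots> = (\<Sum>w\<in>children G v. label_var (\<theta> (v, w)) * path_poly G \<theta> w)"
    unfolding path_poly_def by (simp add: sum.reindex sum_distrib_left)
  finally show ?thesis .
qed

lemma floret_eq_children: "floret G \<theta> v = (\<lambda>w. \<theta> (v, w)) ` children G v"
proof -
  have "out_arcs G v = Pair v ` children G v"
    by (auto simp: out_arcs_def children_def)
  then show ?thesis by (simp add: floret_def image_image)
qed

end

subsection \<open>Columns of stacked partition matrices\<close>

lemma append_rows_assoc:
  assumes "B \<in> carrier_mat p m" "C \<in> carrier_mat q m" "D \<in> carrier_mat s m"
  shows "B @\<^sub>r (C @\<^sub>r D) = (B @\<^sub>r C) @\<^sub>r D"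
  using assms by (intro eq_matI) (auto simp: append_rows_def)

lemma append_zero_rows [simp]: "B \<in> carrier_mat p m \<Longrightarrow> B @\<^sub>r 0\<^sub>m 0 m = B"
  and zero_rows_append [simp]: "B \<in> carrier_mat p m \<Longrightarrow> 0\<^sub>m 0 m @\<^sub>r B = B"
  by (auto simp: append_rows_def)

lemma col_append_rows:
  assumes "B \<in> carrier_mat p m" "C \<in> carrier_mat q m" "j < m"
  shows "col (B @\<^sub>r C) j = col B j @\<^sub>v col C j"
  using assms by (intro eq_vecI) (auto simp: append_rows_def)

text \<open>\<open>stack\<close> folds from the right, while the tree grows by a partition at the
  bottom. Associativity moves the initial matrix of the fold to the end, which gives the recursion
  of \<open>stack\<close> on the level.\<close>

lemma foldr_append_rows:
  assumes "\<And>B. B \<in> set Bs \<Longrightarrow> dim_col B = m" "C \<in> carrier_mat q m"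
  shows "dim_col (foldr (@\<^sub>r) Bs C) = m"
    and "foldr (@\<^sub>r) Bs C = foldr (@\<^sub>r) Bs (0\<^sub>m 0 m) @\<^sub>r C"
proof -
  have dim: "dim_col (foldr (@\<^sub>r) Bs D) = m" if "dim_col D = m" for D
    using assms(1) by (induction Bs) (auto simp: that append_rows_def)
  then show "dim_col (foldr (@\<^sub>r) Bs C) = m" using assms(2) by auto
  show "foldr (@\<^sub>r) Bs C = foldr (@\<^sub>r) Bs (0\<^sub>m 0 m) @\<^sub>r C"
    using assms(1)
  proof (induction Bs)
    case Nil
    then show ?case using assms(2) by simp
  next
    case (Cons B Bs)
    let ?R = "foldr (@\<^sub>r) Bs (0\<^sub>m 0 m)"
    have "dim_col ?R = m" using Cons.prems by (induction Bs) (auto simp: append_rows_def)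
    then have "?R \<in> carrier_mat (dim_row ?R) m" "B \<in> carrier_mat (dim_row B) m"
      using Cons.prems by auto
    then show ?case using Cons append_rows_assoc[OF _ _ assms(2)] by simp
  qed
qed

text \<open>Turns a partition matrix into a function from columns to row indices: the supports of
  the rows are its fibres. Its values are the second components of the edge labels.\<close>

definition block :: "real mat \<Rightarrow> nat \<Rightarrow> nat" where
  "block B j = (THE i. i < dim_row B \<and> B $$ (i, j) = 1)"

lemma partition_matrix_block:
  assumes "partition_matrix m B" "j < m"
  shows "block B j < dim_row B" and "B $$ (block B j, j) = 1"
    and "i < dim_row B \<Longrightarrow> B $$ (i, j) = (if i = block B j then 1 else 0)"
proof -
  have ex: "\<exists>!i. i < dim_row B \<and> B $$ (i, j) = 1"
    using assms unfolding partition_matrix_def by blast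
  from theI'[OF ex] show b: "block B j < dim_row B" "B $$ (block B j, j) = 1"
    unfolding block_def by auto
  show "B $$ (i, j) = (if i = block B j then 1 else 0)" if i: "i < dim_row B"
  proof -
    have "B $$ (i, j) = 0 \<or> B $$ (i, j) = 1"
      using assms i unfolding partition_matrix_def by blast
    then show ?thesis using ex b i by auto
  qed
qed

lemma dim_col_partition_matrix: "partition_matrix m B \<Longrightarrow> dim_col B = m"
  by (simp add: partition_matrix_def)

lemma col_partition_matrix:
  assumes "partition_matrix m B" "j < m"
  shows "col B j = unit_vec (dim_row B) (block B j)"
  using assms by (intro eq_vecI) (simp_all add: partition_matrix_block(1)
      partition_matrix_block(3)[OF assms] dim_col_partition_matrix)

lemma row_supp_partition_matrix:
  assumes "partition_matrix m B" "i < dim_row B"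
  shows "row_supp B i = {j. j < m \<and> block B j = i}"
  using assms partition_matrix_block(3)[OF assms(1) _ assms(2)]
  by (auto simp: row_supp_def dim_col_partition_matrix split: if_splits)

lemma unit_vec_eq_iff:
  "i < n \<Longrightarrow> i' < n \<Longrightarrow> (unit_vec n i :: 'a :: zero_neq_one vec) = unit_vec n i' \<longleftrightarrow> i = i'"
  by (metis index_unit_vec(1) zero_neq_one)

locale multipartition =
  fixes m :: nat and A :: "real mat list"
  assumes multipartition: "multipartition_matrix m A"
begin

abbreviation scol :: "nat \<Rightarrow> nat \<Rightarrow> real vec" where
  "scol l \<equiv> col (stack m A l)"

lemma partition_nth: "l < length A \<Longrightarrow> partition_matrix m (A ! l)"
  using multipartition by (simp add: multipartition_matrix_def)

lemma nth_carrier: "l < length A \<Longrightarrow> A ! l \<in> carrier_mat (dim_row (A ! l)) m"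
  using partition_nth dim_col_partition_matrix by blast

lemma dim_col_stack [simp]: "dim_col (stack m A l) = m"
  unfolding stack_def
proof (rule foldr_append_rows(1))
  show "dim_col B = m" if "B \<in> set (take l A)" for B
    using that multipartition by (auto simp: multipartition_matrix_def
        dest: in_set_takeD dim_col_partition_matrix)
qed auto

lemma stack_carrier: "stack m A l \<in> carrier_mat (dim_row (stack m A l)) m"
  by auto

lemma stack_Suc:
  assumes "l < length A"
  shows "stack m A (Suc l) = stack m A l @\<^sub>r A ! l"
proof -
  have "stack m A (Suc l) = foldr (@\<^sub>r) (take l A) (A ! l)"
    using assms append_zero_rows[OF nth_carrier] by (simp add: stack_def take_Suc_conv_app_nth)
  also have "\<dots> = stack m A l @\<^sub>r A ! l"
    unfolding stack_def
  proof (rule foldr_append_rows(2)[OF _ nth_carrier[OF assms]])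
    show "dim_col B = m" if "B \<in> set (take l A)" for B
      using that multipartition by (auto simp: multipartition_matrix_def
          dest: in_set_takeD dim_col_partition_matrix)
  qed
  finally show ?thesis .
qed

lemma scol_0: "scol 0 j = vNil"
  by (auto simp: stack_def)

lemma scol_Suc:
  assumes "l < length A" "j < m"
  shows "scol (Suc l) j = scol l j @\<^sub>v unit_vec (dim_row (A ! l)) (block (A ! l) j)"
  using assms stack_Suc col_append_rows[OF stack_carrier nth_carrier]
    col_partition_matrix[OF partition_nth] by simp

text \<open>This is why a child determines its parent, and why parent and edge label determine the
  child.\<close>

lemma scol_Suc_eq_iff:
  assumes "l < length A" "j < m" "j' < m"
  shows "scol (Suc l) j = scol (Suc l) j' \<longleftrightarrow>
    scol l j = scol l j' \<and> block (A ! l) j = block (A ! l) j'"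
  using assms by (simp add: scol_Suc append_vec_eq[OF col_dim col_dim] unit_vec_eq_iff
      partition_matrix_block(1)[OF partition_nth])

text \<open>The floret of the vertex at level \<open>l\<close> given by column \<open>j\<close>,
  without the level in the labels; also the matrix floret of the row of
  \<open>cup_matrix m A l\<close> whose support contains \<open>j\<close>.\<close>

definition next_blocks :: "nat \<Rightarrow> nat \<Rightarrow> nat set" where
  "next_blocks l j = {block (A ! l) j' | j'. j' < m \<and> scol l j' = scol l j}"

lemma block_in_next_blocks: "j < m \<Longrightarrow> block (A ! l) j \<in> next_blocks l j"
  unfolding next_blocks_def by blast

lemma next_blocks_cong: "scol l j = scol l j' \<Longrightarrow> next_blocks l j = next_blocks l j'"
  unfolding next_blocks_def by simp

text \<open>Trades the labeling chosen by \<open>SOME\<close> for column representatives. Row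
  \<open>lab j\<close> is supported on the columns agreeing with \<open>j\<close> up to level
  \<open>l\<close>, and it meets row \<open>i\<close> of the next partition iff one of them has
  block \<open>i\<close>.\<close>

lemma connected_rows_cup_matrix:
  assumes "l < length A"
  obtains lab where
    "lab ` {..<m} = {..<dim_row (cup_matrix m A l)}"
    "\<And>j. j < m \<Longrightarrow> connected_rows (cup_matrix m A l) (A ! l) (lab j) = next_blocks l j"
proof -
  define lab where "lab = (SOME lab. column_labeling m (stack m A l) lab)"
  have lab: "column_labeling m (stack m A l) lab"
    unfolding lab_def using column_labeling_exists by (rule someI_ex)
  have cup: "cup_matrix m A l =
      mat (card (scol l ` {..<m})) m (\<lambda>(i, j). if i = lab j then 1 else 0)"
    by (simp add: cup_matrix_def lab_def Let_def)
  have im: "lab ` {..<m} = {..<dim_row (cup_matrix m A l)}"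
    using lab by (simp add: cup column_labeling_def)
  have "connected_rows (cup_matrix m A l) (A ! l) (lab j) = next_blocks l j" if j: "j < m" for j
  proof -
    have "lab j < dim_row (cup_matrix m A l)" using im j by auto
    then have "row_supp (cup_matrix m A l) (lab j) = {j'. j' < m \<and> lab j' = lab j}"
      by (auto simp: cup row_supp_def split: if_splits)
    also have "\<dots> = {j'. j' < m \<and> scol l j' = scol l j}"
      using lab j by (auto simp: column_labeling_def)
    finally have "row_supp (cup_matrix m A l) (lab j) = {j'. j' < m \<and> scol l j' = scol l j}" .
    note supp = this row_supp_partition_matrix[OF partition_nth[OF assms]]
    have "i \<in> connected_rows (cup_matrix m A l) (A ! l) (lab j) \<longleftrightarrow> i \<in> next_blocks l j" for i
    proof -
      have "i \<in> connected_rows (cup_matrix m A l) (A ! l) (lab j) \<longleftrightarrow> i < dim_row (A ! l) \<and>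
          {j'. j' < m \<and> scol l j' = scol l j} \<inter> {j'. j' < m \<and> block (A ! l) j' = i} \<noteq> {}"
        unfolding connected_rows_def rows_connected_def mem_Collect_eq supp(1)
        by (rule conj_cong[OF refl]) (simp only: supp(2))
      then show ?thesis
        using partition_matrix_block(1)[OF partition_nth[OF assms]] unfolding next_blocks_def by blast
    qed
    then show ?thesis by blast
  qed
  with im show thesis by (rule that)
qed

end

subsection \<open>Consequences of the GRIP\<close>

locale grip = multipartition +
  assumes grip: "GRIP m A"
begin

text \<open>For \<open>l > 0\<close> this is the floret condition of the GRIP read on columns. The
  GRIP does not speak of level 0, but there all columns are empty and give the same floret.\<close>

lemma next_blocks_eq_or_disjoint:
  assumes "l < length A" "j < m" "j' < m"
  shows "next_blocks l j = next_blocks l j' \<or> next_blocks l j \<inter> next_blocks l j' = {}"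
proof (cases l)
  case 0
  then show ?thesis using next_blocks_cong[of 0] scol_0 by auto
next
  case (Suc n)
  obtain lab where lab: "lab ` {..<m} = {..<dim_row (cup_matrix m A l)}"
    "\<And>j. j < m \<Longrightarrow> connected_rows (cup_matrix m A l) (A ! l) (lab j) = next_blocks l j"
    using connected_rows_cup_matrix[OF assms(1)] by blast
  have "floret_condition (cup_matrix m A l) (A ! l)"
    using grip assms(1) Suc by (auto simp: GRIP_def Let_def)
  moreover have "lab j < dim_row (cup_matrix m A l)" "lab j' < dim_row (cup_matrix m A l)"
    using lab(1) assms by auto
  ultimately show ?thesis
    unfolding floret_condition_def using lab(2) assms by metis
qed

lemma floret_indicator_in_row_space:
  assumes "0 < l" "l < length A" "a < m"
  obtains f where "f \<in> vec_space.row_space m (stack m A l)"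
    and "\<And>j. j < m \<Longrightarrow> f $ j = (if next_blocks l j = next_blocks l a then 1 else 0)"
proof -
  let ?B = "cup_matrix m A l"
  obtain lab where lab: "lab ` {..<m} = {..<dim_row ?B}"
    "\<And>j. j < m \<Longrightarrow> connected_rows ?B (A ! l) (lab j) = next_blocks l j"
    using connected_rows_cup_matrix[OF assms(2)] by blast
  have "matrix_florets ?B (A ! l) = next_blocks l ` {..<m}"
    unfolding matrix_florets_def lab(1)[symmetric] image_image using lab(2) by simp
  define Fs where "Fs = (SOME Fs. distinct Fs \<and> set Fs = matrix_florets ?B (A ! l))"
  have "distinct Fs \<and> set Fs = matrix_florets ?B (A ! l)"
    unfolding Fs_def using matrix_florets_enum by (rule someI_ex)
  then have Fs: "set Fs = next_blocks l ` {..<m}" using \<open>matrix_florets _ _ = _\<close> by simp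
  then obtain t where t: "t < length Fs" "Fs ! t = next_blocks l a"
    using assms(3) in_set_conv_nth[of "next_blocks l a" Fs] by auto
  have cap: "cap_matrix ?B (A ! l) = mat (length Fs) m
      (\<lambda>(t, j). if (THE i. i < dim_row (A ! l) \<and> j \<in> row_supp (A ! l) i) \<in> Fs ! t then 1 else 0)"
    unfolding cap_matrix_def Fs_def[symmetric] Let_def
    using dim_col_partition_matrix[OF partition_nth[OF assms(2)]] by simp
  show thesis
  proof
    have "set (rows (cap_matrix ?B (A ! l))) \<subseteq> vec_space.row_space m (stack m A l)"
      using grip assms by (auto simp: GRIP_def Let_def)
    moreover have "row (cap_matrix ?B (A ! l)) t \<in> set (rows (cap_matrix ?B (A ! l)))"
      using t(1) by (auto simp: rows_def cap)
    ultimately show "row (cap_matrix ?B (A ! l)) t \<in> vec_space.row_space m (stack m A l)"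
      by blast
    fix j assume j: "j < m"
    note P = partition_nth[OF assms(2)]
    have "(THE i. i < dim_row (A ! l) \<and> j \<in> row_supp (A ! l) i) = block (A ! l) j"
      by (rule the_equality) (use j partition_matrix_block(1)[OF P j] in
          \<open>auto simp: row_supp_partition_matrix[OF P]\<close>)
    \<comment> \<open>If the block of \<open>j\<close> lies in the floret at \<open>a\<close>, the
      two florets meet and hence agree; so the cap matrix entry compares florets.\<close>
    moreover have "block (A ! l) j \<in> next_blocks l a \<longleftrightarrow> next_blocks l j = next_blocks l a"
      using next_blocks_eq_or_disjoint[OF assms(2) j assms(3)] block_in_next_blocks[OF j] by blast
    ultimately show "row (cap_matrix ?B (A ! l)) t $ j =
        (if next_blocks l j = next_blocks l a then 1 else 0)"
      using t j by (simp add: cap)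
  qed
qed

text \<open>A combination of the rows with coefficients \<open>y\<close> has entry
  \<open>scol l j \<bullet> y\<close> at \<open>j\<close>, a linear functional of the
  column.\<close>

lemma row_space_additive:
  assumes "f \<in> vec_space.row_space m (stack m A l)" "a < m" "b < m" "c < m" "d < m"
    and "scol l a + scol l b = scol l c + scol l d"
  shows "f $ a + f $ b = f $ c + f $ d"
proof -
  obtain y where y: "y \<in> carrier_vec (dim_row (stack m A l))" "(stack m A l)\<^sup>T *\<^sub>v y = f"
    using assms(1) vec_space.row_space_eq[OF stack_carrier] by blast
  have f: "f $ j = scol l j \<bullet> y" if "j < m" for j
    using y(2) that by auto
  have add: "f $ i + f $ j = (scol l i + scol l j) \<bullet> y" if "i < m" "j < m" for i j
    using that y(1) by (simp add: f add_scalar_prod_distrib[of _ "dim_row (stack m A l)"])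
  show ?thesis using assms add by simp
qed

lemma next_blocks_pair_eq:
  assumes "0 < l" "l < length A" and "a < m" "b < m" "c < m" "d < m"
    and "scol l a + scol l b = scol l c + scol l d"
  shows "next_blocks l a = next_blocks l c \<and> next_blocks l b = next_blocks l d \<or>
    next_blocks l a = next_blocks l d \<and> next_blocks l b = next_blocks l c"
proof -
  let ?ind = "\<lambda>i j. if next_blocks l j = next_blocks l i then 1 else 0 :: real"
  have ind: "?ind e a + ?ind e b = ?ind e c + ?ind e d" if e: "e < m" for e
  proof -
    obtain f where f: "f \<in> vec_space.row_space m (stack m A l)" "\<And>j. j < m \<Longrightarrow> f $ j = ?ind e j"
      using floret_indicator_in_row_space[OF assms(1,2) e] by blast
    show ?thesis
      using row_space_additive[OF f(1) assms(3-)] unfolding assms(3-6)[THEN f(2)] .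
  qed
  \<comment> \<open>For \<open>e = a\<close>: both \<open>c\<close> and \<open>d\<close> share the
    floret of \<open>a\<close> if \<open>b\<close> does, and exactly one of them otherwise. In the
    latter case \<open>e = b\<close> gives the other one the floret of \<open>b\<close>.\<close>
  show ?thesis
    using ind[OF assms(3)] ind[OF assms(4)] by (simp split: if_splits)
qed

end

subsection \<open>The tree of a multipartition matrix\<close>

context multipartition
begin

abbreviation tree :: "column_vertex pair_pre_digraph" where
  "tree \<equiv> partition_tree m A"

abbreviation lbl :: "column_vertex \<times> column_vertex \<Rightarrow> nat \<times> nat" where
  "lbl \<equiv> tree_label m A"

definition vtx :: "nat \<Rightarrow> nat \<Rightarrow> column_vertex" where
  "vtx l j = (l, scol l j)"

lemma vtx_0: "vtx 0 j = tree_root"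
  by (simp add: vtx_def tree_root_def scol_0)

lemma vtx_eq_iff: "vtx l j = vtx l' j' \<longleftrightarrow> l = l' \<and> scol l j = scol l j'"
  by (auto simp: vtx_def)

lemma vec_first_scol_Suc:
  assumes "l < length A" "j < m"
  shows "vec_first (scol (Suc l) j) (dim_row (stack m A l)) = scol l j"
  by (rule eq_vecI) (auto simp: scol_Suc[OF assms] vec_first_def)

lemma set_cols_stack: "set (cols (stack m A l)) = scol l ` {..<m}"
  by (auto simp: cols_def)

text \<open>For \<open>m > 0\<close> every column represents the root at level 0. For
  \<open>m = 0\<close> no column does, so the root is inserted separately.\<close>

lemma pverts_tree: "pverts tree = insert tree_root {vtx l j | l j. l \<le> length A \<and> j < m}"
proof (intro subset_antisym subsetI)
  fix x assume "x \<in> pverts tree"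
  then show "x \<in> insert tree_root {vtx l j | l j. l \<le> length A \<and> j < m}"
    by (auto simp: partition_tree_def set_cols_stack vtx_def)
next
  fix x assume x: "x \<in> insert tree_root {vtx l j | l j. l \<le> length A \<and> j < m}"
  then consider "x = tree_root" | l j where "x = vtx (Suc l) j" "Suc l \<le> length A" "j < m"
  proof (cases "x = tree_root")
    case False
    with x obtain l j where lj: "x = vtx l j" "l \<le> length A" "j < m" by blast
    with False vtx_0 obtain n where "l = Suc n" by (cases l) auto
    with lj that(2) show thesis by blast
  qed
  then show "x \<in> pverts tree"
    by cases (auto simp: partition_tree_def set_cols_stack vtx_def)
qed

text \<open>Truncating column \<open>j\<close> of level \<open>l + 1\<close> gives column
  \<open>j\<close> of level \<open>l\<close>, so both ends of an arc have a common
  representative.\<close>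

lemma parcs_tree: "parcs tree = {(vtx l j, vtx (Suc l) j) | l j. l < length A \<and> j < m}"
proof (intro subset_antisym subsetI)
  fix x assume "x \<in> parcs tree"
  then obtain l j where x: "1 \<le> l" "l \<le> length A" "j < m"
    "x = ((l - 1, vec_first (scol l j) (dim_row (stack m A (l - 1)))), (l, scol l j))"
    by (auto simp: partition_tree_def set_cols_stack)
  then obtain n where "l = Suc n" by (cases l) auto
  with x have "x = (vtx n j, vtx (Suc n) j)" "n < length A"
    using vec_first_scol_Suc[of n j] by (auto simp: vtx_def)
  with x(3) show "x \<in> {(vtx l j, vtx (Suc l) j) | l j. l < length A \<and> j < m}" by blast
next
  fix x assume "x \<in> {(vtx l j, vtx (Suc l) j) | l j. l < length A \<and> j < m}"
  then obtain l j where x: "x = (vtx l j, vtx (Suc l) j)" "l < length A" "j < m" by blast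
  then have "x = ((Suc l - 1, vec_first (scol (Suc l) j) (dim_row (stack m A (Suc l - 1)))),
      (Suc l, scol (Suc l) j))"
    by (simp add: vtx_def vec_first_scol_Suc)
  with x show "x \<in> parcs tree"
    unfolding partition_tree_def set_cols_stack pair_pre_digraph.simps by fastforce
qed

lemma tree_graded: "graded_tree tree tree_root fst"
proof
  show "finite (pverts tree)"
  proof -
    have "{vtx l j | l j. l \<le> length A \<and> j < m} = (\<lambda>(l, j). vtx l j) ` ({..length A} \<times> {..<m})"
      by auto
    then show ?thesis by (simp add: pverts_tree)
  qed
  show "finite (parcs tree)"
  proof -
    have "parcs tree = (\<lambda>(l, j). (vtx l j, vtx (Suc l) j)) ` ({..<length A} \<times> {..<m})"
      by (auto simp: parcs_tree)
    then show ?thesis by simp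
  qed
  show "fst e \<in> pverts tree" "snd e \<in> pverts tree" if "e \<in> parcs tree" for e
    using that by (fastforce simp: parcs_tree pverts_tree)+
  show "tree_root \<in> pverts tree" by (simp add: pverts_tree)
  show "fst v = Suc (fst u)" if "(u, v) \<in> parcs tree" for u v
    using that by (auto simp: parcs_tree vtx_def)
  show "fst v = 0 \<longleftrightarrow> v = tree_root" if "v \<in> pverts tree" for v
    using that by (auto simp: pverts_tree vtx_def tree_root_def scol_0)
  show "\<exists>!u. (u, v) \<in> parcs tree" if vert: "v \<in> pverts tree" "v \<noteq> tree_root" for v
  proof -
    obtain l j where v: "v = vtx (Suc l) j" "l < length A" "j < m"
    proof -
      from vert obtain l j where lj: "v = vtx l j" "l \<le> length A" "j < m"
        unfolding pverts_tree by blast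
      with vert(2) vtx_0 obtain n where "l = Suc n" by (cases l) auto
      with lj show thesis by (intro that) auto
    qed
    show ?thesis
    proof (rule ex1I[of _ "vtx l j"])
      show "(vtx l j, v) \<in> parcs tree" using v by (auto simp: parcs_tree)
      show "u = vtx l j" if "(u, v) \<in> parcs tree" for u
        using that v by (auto simp: parcs_tree vtx_eq_iff scol_Suc_eq_iff)
    qed
  qed
qed

sublocale tree: graded_tree tree tree_root fst
  by (rule tree_graded)

lemma tree_label_arc:
  assumes "l < length A" "j < m"
  shows "lbl (u, vtx (Suc l) j) = (Suc l, block (A ! l) j)"
proof -
  have "scol (Suc l) j $ (dim_row (stack m A l) + i) = A ! l $$ (i, j)" if "i < dim_row (A ! l)" for i
    using that assms partition_matrix_block[OF partition_nth[OF assms(1)] assms(2)]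
    by (simp add: scol_Suc)
  then have "(i < dim_row (A ! l) \<and> scol (Suc l) j $ (dim_row (stack m A l) + i) = 1) \<longleftrightarrow>
      (i < dim_row (A ! l) \<and> A ! l $$ (i, j) = 1)" for i
    by auto
  then show ?thesis by (simp add: tree_label_def vtx_def block_def)
qed

lemma children_tree:
  assumes "l < length A" "j < m"
  shows "children tree (vtx l j) = {vtx (Suc l) j' | j'. j' < m \<and> scol l j' = scol l j}"
proof -
  have "w \<in> children tree (vtx l j) \<longleftrightarrow>
      (\<exists>j'. w = vtx (Suc l) j' \<and> j' < m \<and> scol l j' = scol l j)" for w
    using assms(1) unfolding children_def parcs_tree mem_Collect_eq prod.inject vtx_eq_iff by metis
  then show ?thesis by blast
qed

text \<open>Below the last level a column is continued by its own next block, so all leaves are on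
  the last level. For \<open>m = 0\<close> the root is a leaf that no column represents.\<close>

lemma leaves_tree:
  assumes "0 < m"
  shows "leaves tree = {vtx (length A) j | j. j < m}"
proof -
  have "children tree (vtx (length A) j) = {}" for j
    by (auto simp: children_def parcs_tree vtx_eq_iff)
  moreover have "children tree (vtx l j) \<noteq> {}" if "l < length A" "j < m" for l j
    using children_tree[OF that] that by blast
  moreover have "pverts tree = {vtx l j | l j. l \<le> length A \<and> j < m}"
    unfolding pverts_tree using assms vtx_0 by (metis (mono_tags, lifting) insert_absorb le0 mem_Collect_eq)
  ultimately show ?thesis
    unfolding leaves_def by (auto simp: le_less)
qed

text \<open>Links the florets of the tree to those of the matrices; the component
  \<open>Suc l\<close> keeps different levels apart.\<close>

lemma floret_tree:
  assumes "l < length A" "j < m"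
  shows "floret tree lbl (vtx l j) = Pair (Suc l) ` next_blocks l j"
proof -
  have "floret tree lbl (vtx l j) =
      (\<lambda>j'. lbl (vtx l j, vtx (Suc l) j')) ` {j'. j' < m \<and> scol l j' = scol l j}"
    by (auto simp: tree.floret_eq_children children_tree[OF assms])
  also have "\<dots> = Pair (Suc l) ` next_blocks l j"
    using assms by (auto simp: next_blocks_def tree_label_arc)
  finally show ?thesis .
qed

lemma inj_on_tree_label: "inj_on (\<lambda>w. lbl (v, w)) (children tree v)"
proof (rule inj_onI)
  fix w w' assume w: "w \<in> children tree v" "w' \<in> children tree v" "lbl (v, w) = lbl (v, w')"
  then obtain l j j' where "l < length A" "j < m" "j' < m" "scol l j = scol l j'"
    "w = vtx (Suc l) j" "w' = vtx (Suc l) j'"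
    unfolding children_def parcs_tree mem_Collect_eq prod.inject by (metis vtx_eq_iff)
  with w(3) show "w = w'" by (simp add: tree_label_arc vtx_eq_iff scol_Suc_eq_iff)
qed

end

subsection \<open>Balancedness\<close>

context grip
begin

text \<open>A column representing the child of \<open>vtx l j\<close> along label \<open>s\<close>.
  For \<open>s\<close> in \<open>next_blocks l j\<close> the child itself does not depend on the
  choice.\<close>

definition extend :: "nat \<Rightarrow> nat \<Rightarrow> nat \<Rightarrow> nat" where
  "extend l j s = (SOME j'. j' < m \<and> scol l j' = scol l j \<and> block (A ! l) j' = s)"

lemma extend:
  assumes "s \<in> next_blocks l j"
  shows "extend l j s < m" "scol l (extend l j s) = scol l j" "block (A ! l) (extend l j s) = s"
proof -
  have "\<exists>j'. j' < m \<and> scol l j' = scol l j \<and> block (A ! l) j' = s"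
    using assms unfolding next_blocks_def by blast
  from someI_ex[OF this] show "extend l j s < m" "scol l (extend l j s) = scol l j"
    "block (A ! l) (extend l j s) = s"
    unfolding extend_def by blast+
qed

text \<open>Summing over labels instead of children gives vertices with the same floret the same
  index set, so their expansions can be compared term by term.\<close>

lemma path_poly_tree:
  assumes "l < length A" "j < m"
  shows "path_poly tree lbl (vtx l j) =
    (\<Sum>s\<in>next_blocks l j. label_var (Suc l, s) * path_poly tree lbl (vtx (Suc l) (extend l j s)))"
proof -
  have "vtx l j \<notin> leaves tree"
    using assms leaves_tree by (auto simp: vtx_eq_iff)
  then have "path_poly tree lbl (vtx l j) = (\<Sum>w\<in>children tree (vtx l j).
      label_var (lbl (vtx l j, w)) * path_poly tree lbl w)"
    by (rule tree.path_poly_inner)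
  also have "children tree (vtx l j) = (\<lambda>s. vtx (Suc l) (extend l j s)) ` next_blocks l j"
  proof -
    have "vtx (Suc l) j' = vtx (Suc l) (extend l j (block (A ! l) j'))" "block (A ! l) j' \<in> next_blocks l j"
      if "j' < m" "scol l j' = scol l j" for j'
    proof -
      show "block (A ! l) j' \<in> next_blocks l j" using that unfolding next_blocks_def by blast
      from extend[OF this] that show "vtx (Suc l) j' = vtx (Suc l) (extend l j (block (A ! l) j'))"
        by (simp add: vtx_eq_iff scol_Suc_eq_iff[OF assms(1)])
    qed
    then show ?thesis using extend unfolding children_tree[OF assms(1,2)] by blast
  qed
  also have "(\<Sum>w\<in>(\<lambda>s. vtx (Suc l) (extend l j s)) ` next_blocks l j.
      label_var (lbl (vtx l j, w)) * path_poly tree lbl w) =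
      (\<Sum>s\<in>next_blocks l j. label_var (lbl (vtx l j, vtx (Suc l) (extend l j s))) *
        path_poly tree lbl (vtx (Suc l) (extend l j s)))"
  proof (subst sum.reindex)
    show "inj_on (\<lambda>s. vtx (Suc l) (extend l j s)) (next_blocks l j)"
      using extend by (auto simp: inj_on_def vtx_eq_iff scol_Suc_eq_iff[OF assms(1)])
  qed simp
  also have "\<dots> = (\<Sum>s\<in>next_blocks l j. label_var (Suc l, s) * path_poly tree lbl (vtx (Suc l) (extend l j s)))"
    by (rule sum.cong) (use extend tree_label_arc[OF assms(1)] in simp_all)
  finally show ?thesis .
qed

text \<open>The entries appended at level \<open>l + 1\<close> are unit vectors of the blocks; under
  either matching both pairs have the same sum of these.\<close>

lemma scol_Suc_add_eq:
  assumes "l < length A" "a < m" "b < m" "c < m" "d < m"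
    and "scol l a + scol l b = scol l c + scol l d"
    and "block (A ! l) a = block (A ! l) c \<and> block (A ! l) b = block (A ! l) d \<or>
      block (A ! l) a = block (A ! l) d \<and> block (A ! l) b = block (A ! l) c"
  shows "scol (Suc l) a + scol (Suc l) b = scol (Suc l) c + scol (Suc l) d"
  using assms
  by (auto simp: scol_Suc append_vec_add[OF col_dim col_dim unit_vec_carrier unit_vec_carrier]
      comm_add_vec[OF unit_vec_carrier unit_vec_carrier])

text \<open>The balance identity for sibling pairs does not reproduce itself when the products are
  expanded. The equation of column sums does, which makes the downward induction on the level
  possible.\<close>

lemma path_poly_mult_eq:
  assumes "0 < l" "l \<le> length A" "a < m" "b < m" "c < m" "d < m"
    and "scol l a + scol l b = scol l c + scol l d"
  shows "path_poly tree lbl (vtx l a) * path_poly tree lbl (vtx l b) =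
    path_poly tree lbl (vtx l c) * path_poly tree lbl (vtx l d)"
  using assms(2,1,3-)
proof (induction l arbitrary: a b c d rule: inc_induct)
  case base
  then have "path_poly tree lbl (vtx (length A) j) = 1" if "j < m" for j
    using that leaves_tree by (intro tree.path_poly_leaf) auto
  with base show ?case by simp
next
  case (step l)
  let ?p = "\<lambda>n j. path_poly tree lbl (vtx n j)"
  \<comment> \<open>The case of florets matching in the given order: the terms for labels
    \<open>s\<close> and \<open>t\<close> agree on both sides by the induction hypothesis.\<close>
  have main: "?p l a * ?p l b = ?p l c * ?p l d"
    if abcd: "a < m" "b < m" "c < m" "d < m" "scol l a + scol l b = scol l c + scol l d"
    and fl: "next_blocks l a = next_blocks l c" "next_blocks l b = next_blocks l d" for a b c d
  proof -
    have "?p (Suc l) (extend l a s) * ?p (Suc l) (extend l b t) = ?p (Suc l) (extend l c s) * ?p (Suc l) (extend l d t)"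
      if "s \<in> next_blocks l a" "t \<in> next_blocks l b" for s t
    proof -
      have "scol (Suc l) (extend l a s) + scol (Suc l) (extend l b t) = scol (Suc l) (extend l c s) + scol (Suc l) (extend l d t)"
        by (rule scol_Suc_add_eq[OF step.hyps(2)]) (use extend that fl abcd(5) in simp_all)
      with extend that fl show ?thesis by (intro step.IH) simp_all
    qed
    then have *: "(label_var (Suc l, s) * ?p (Suc l) (extend l a s)) * (label_var (Suc l, t) * ?p (Suc l) (extend l b t)) =
        (label_var (Suc l, s) * ?p (Suc l) (extend l c s)) * (label_var (Suc l, t) * ?p (Suc l) (extend l d t))"
      if "s \<in> next_blocks l a" "t \<in> next_blocks l b" for s t
      using that by (simp add: mult.assoc mult.left_commute)
    note p = abcd(1-4)[THEN path_poly_tree[OF step.hyps(2)]]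
    show ?thesis
      unfolding p fl[symmetric] sum_product by (intro sum.cong refl *)
  qed
  from next_blocks_pair_eq[OF step.prems(1) step.hyps(2) step.prems(2-6)] show ?case
  proof
    assume "next_blocks l a = next_blocks l c \<and> next_blocks l b = next_blocks l d"
    with main[of a b c d] step.prems show ?thesis by blast
  next
    \<comment> \<open>The crossed matching becomes the straight one once \<open>c\<close> and
      \<open>d\<close> trade places.\<close>
    assume "next_blocks l a = next_blocks l d \<and> next_blocks l b = next_blocks l c"
    moreover have "scol l c + scol l d = scol l d + scol l c"
      by (rule comm_add_vec[OF col_dim col_dim])
    ultimately have "?p l a * ?p l b = ?p l d * ?p l c"
      using main[of a b d c] step.prems by simp
    then show ?thesis by (simp add: mult.commute)
  qed
qed

section \<open>Stagedness, stratification and balancedness of the tree\<close>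

lemma floret_empty_iff: "v \<in> pverts tree \<Longrightarrow> floret tree lbl v = {} \<longleftrightarrow> v \<in> leaves tree"
  by (simp add: tree.floret_eq_children leaves_def)

lemma vertex_cases:
  assumes "v \<in> pverts tree"
  obtains "v \<in> leaves tree" | l j where "l < length A" "j < m" "v = vtx l j"
proof (cases "v \<in> leaves tree")
  case False
  then obtain w where "(v, w) \<in> parcs tree" using assms by (auto simp: leaves_def children_def)
  with that show thesis by (auto simp: parcs_tree)
qed

text \<open>Without columns the tree is the bare root, so its leaf has level 0 whatever the length
  of \<open>A\<close>. All leaves share the empty floret, so stratification needs them on one
  level.\<close>

lemma fst_leaf: "v \<in> leaves tree \<Longrightarrow> fst v = (if m = 0 then 0 else length A)"
proof (cases "m = 0")
  case True
  assume "v \<in> leaves tree"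
  then have "v \<in> pverts tree" by (simp add: leaves_def)
  then have "v = tree_root" using True unfolding pverts_tree by simp
  with True show ?thesis by (simp add: tree_root_def)
next
  case False
  assume "v \<in> leaves tree"
  with False leaves_tree show ?thesis by (auto simp: vtx_def)
qed

lemma staged_tree_tree: "staged_tree tree tree_root lbl"
  unfolding staged_tree_def
proof (intro conjI ballI)
  show "rooted_tree tree tree_root" by (rule tree.rooted_tree)
  show "inj_on lbl (out_arcs tree v)" for v
    using inj_on_tree_label[of v] by (auto simp: inj_on_def out_arcs_def children_def)
  fix v w assume v: "v \<in> pverts tree" and w: "w \<in> pverts tree"
  show "floret tree lbl v = floret tree lbl w \<or> floret tree lbl v \<inter> floret tree lbl w = {}"
  proof (cases "v \<in> leaves tree \<or> w \<in> leaves tree")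
    case True
    with v w show ?thesis using floret_empty_iff by blast
  next
    case False
    obtain l j where lj: "l < length A" "j < m" "v = vtx l j"
      using vertex_cases[OF v] False by blast
    obtain l' j' where lj': "l' < length A" "j' < m" "w = vtx l' j'"
      using vertex_cases[OF w] False by blast
    show ?thesis
    proof (cases "l = l'")
      case True
      with next_blocks_eq_or_disjoint[OF lj(1,2), of j'] lj'(2) show ?thesis
        unfolding lj(3) lj'(3) floret_tree[OF lj(1,2)] floret_tree[OF lj'(1,2)] by blast
    next
      \<comment> \<open>The labels carry their level in the first component, so these florets are
        disjoint.\<close>
      case False
      then show ?thesis
        unfolding lj(3) lj'(3) floret_tree[OF lj(1,2)] floret_tree[OF lj'(1,2)] by blast
    qed
  qed
qed

text \<open>The floret at an inner vertex contains the label of its representing column, and that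
  label records the level.\<close>

lemma floret_eqD:
  assumes "l < length A" "j < m" "l' < length A" "j' < m"
    and "floret tree lbl (vtx l j) = floret tree lbl (vtx l' j')"
  shows "l = l'"
proof -
  have "(Suc l, block (A ! l) j) \<in> floret tree lbl (vtx l j)"
    unfolding floret_tree[OF assms(1,2)] using block_in_next_blocks[OF assms(2)] by (rule imageI)
  then show ?thesis unfolding assms(5) floret_tree[OF assms(3,4)] by blast
qed

lemma stratified_tree: "stratified tree tree_root lbl"
  unfolding stratified_def
proof (intro conjI ballI impI)
  show "level tree tree_root v = level tree tree_root w" if "v \<in> leaves tree" "w \<in> leaves tree" for v w
    using that fst_leaf by (simp add: leaves_def tree.level_eq_rank)
  fix v w assume vw: "v \<in> pverts tree" "w \<in> pverts tree" "floret tree lbl v = floret tree lbl w"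
  have "fst v = fst w"
  proof (cases "v \<in> leaves tree")
    case True
    with vw have "w \<in> leaves tree" using floret_empty_iff by metis
    with True show ?thesis by (simp add: fst_leaf)
  next
    case False
    with vw have "w \<notin> leaves tree" using floret_empty_iff by metis
    then obtain l' j' where w: "l' < length A" "j' < m" "w = vtx l' j'"
      using vertex_cases[OF vw(2)] by blast
    obtain l j where "l < length A" "j < m" "v = vtx l j"
      using vertex_cases[OF vw(1)] False by blast
    with floret_eqD[OF _ _ w(1,2)] vw(3) w(3) show ?thesis by (simp add: vtx_def)
  qed
  with vw show "level tree tree_root v = level tree tree_root w" by (simp add: tree.level_eq_rank)
qed

lemma balanced_tree: "balanced tree lbl"
  unfolding balanced_def
proof (intro ballI impI)
  fix v w v' v'' w' w''
  assume vw: "v \<in> pverts tree" "w \<in> pverts tree" "floret tree lbl v = floret tree lbl w"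
    and ch: "v' \<in> children tree v" "v'' \<in> children tree v" "w' \<in> children tree w" "w'' \<in> children tree w"
    and eq: "v' \<noteq> v'' \<and> w' \<noteq> w'' \<and> lbl (v, v') = lbl (w, w') \<and> lbl (v, v'') = lbl (w, w'')"
  from ch vw obtain l j l' j' where lj: "l < length A" "j < m" "v = vtx l j"
    and lj': "l' < length A" "j' < m" "w = vtx l' j'"
    by (auto simp: children_def parcs_tree)
  have [simp]: "l' = l" using floret_eqD lj lj' vw(3) by blast
  \<comment> \<open>\<open>a\<close> and \<open>d\<close> represent children of \<open>v\<close>,
    \<open>b\<close> and \<open>c\<close> children of \<open>w\<close>; the names follow the order
    of the factors in \<open>path_poly_mult_eq\<close>.\<close>
  from ch obtain a b c d
    where a: "a < m" "scol l a = scol l j" "v' = vtx (Suc l) a"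
      and b: "b < m" "scol l b = scol l j'" "w'' = vtx (Suc l) b"
      and c: "c < m" "scol l c = scol l j'" "w' = vtx (Suc l) c"
      and d: "d < m" "scol l d = scol l j" "v'' = vtx (Suc l) d"
    using lj lj' by (auto simp: children_tree)
  have bl: "block (A ! l) a = block (A ! l) c" "block (A ! l) d = block (A ! l) b"
    using eq a b c d lj by (simp_all add: tree_label_arc)
  \<comment> \<open>One level up, both sides add the columns of \<open>v\<close> and
    \<open>w\<close>, in opposite orders.\<close>
  have "scol l a + scol l b = scol l c + scol l d"
    unfolding a(2) b(2) c(2) d(2) by (rule comm_add_vec[OF col_dim col_dim])
  \<comment> \<open>Equal edge labels match the block of \<open>a\<close> with that of
    \<open>c\<close> and the block of \<open>b\<close> with that of \<open>d\<close>.\<close>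
  then have "scol (Suc l) a + scol (Suc l) b = scol (Suc l) c + scol (Suc l) d"
    using bl(1) bl(2)[symmetric] by (intro scol_Suc_add_eq[OF lj(1) a(1) b(1) c(1) d(1)]) blast+
  then show "path_poly tree lbl v' * path_poly tree lbl w'' = path_poly tree lbl w' * path_poly tree lbl v''"
    unfolding a(3) b(3) c(3) d(3)
    using lj(1) by (intro path_poly_mult_eq[OF _ _ a(1) b(1) c(1) d(1)]) simp_all
qed

end

theorem theorem4p12:
  fixes m :: nat and A :: "real mat list"
  assumes "multipartition_matrix m A"
    and "GRIP m A"
  shows "staged_tree (partition_tree m A) tree_root (tree_label m A)
    \<and> stratified (partition_tree m A) tree_root (tree_label m A)
    \<and> balanced (partition_tree m A) (tree_label m A)"
proof -
  interpret grip m A using assms by unfold_locales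
  show ?thesis using staged_tree_tree stratified_tree balanced_tree by blast
qed

end
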